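(* Let $G_w$ be a weighted bicyclic graph. Then the rank of $A(G_w)$ equals $2$ if and only if $G_w$ is (isomorphic as a weighted graph to) $\theta(1,1,1)_w$ with weights satisfying $a_1c_2=a_2c_1$ and $a_1b_2=a_2b_1$.
   Context: A weighted graph $G_w$ is a simple graph with a positive weight on each edge; its adjacency matrix $A(G_w)$ has entry $w(xy)$ if $xy$ is an edge and $0$ otherwise. A bicyclic graph is a connected simple graph with $|E|=|V|+1$. $\theta(1,1,1)_w$ is the weighted graph with vertices $u,v,x_1,y_1,z_1$ and edges $ux_1,x_1v,uy_1,y_1v,uz_1,z_1v$ with positive weights $w(ux_1)=a_1$, $w(x_1v)=a_2$, $w(uy_1)=b_1$, $w(y_1v)=b_2$, $w(uz_1)=c_1$, $w(z_1v)=c_2$. *)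

theory Defs
  imports "HOL-Analysis.Analysis"
begin

text \<open>
  The vertex set of a graph is the whole of the type \<open>'v\<close>; finite graphs are those with
  \<open>'v\<close> of class \<open>finite\<close>. Edges are unordered pairs. The values of \<open>weight\<close> outside
  \<open>edges\<close> carry no information.
\<close>

record 'v wgraph =
  edges :: "'v set set"
  weight :: "'v set \<Rightarrow> real"

definition weighted_graph :: "'v wgraph \<Rightarrow> bool" where
  "weighted_graph G \<longleftrightarrow>
     (\<forall>e\<in>edges G. \<exists>x y. x \<noteq> y \<and> e = {x, y}) \<and> (\<forall>e\<in>edges G. weight G e > 0)"

definition adjacency_matrix :: "'v::finite wgraph \<Rightarrow> real ^ 'v ^ 'v" where
  "adjacency_matrix G =
     (\<chi> x y. if {x, y} \<in> edges G then weight G {x, y} else 0)"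

definition connected_graph :: "'v wgraph \<Rightarrow> bool" where
  "connected_graph G \<longleftrightarrow> (\<forall>x y. (x, y) \<in> {(p, q). {p, q} \<in> edges G}\<^sup>*)"

definition bicyclic :: "'v::finite wgraph \<Rightarrow> bool" where
  "bicyclic G \<longleftrightarrow> connected_graph G \<and> card (edges G) = CARD('v) + 1"

definition wgraph_iso :: "'v wgraph \<Rightarrow> 'w wgraph \<Rightarrow> bool" where
  "wgraph_iso G H \<longleftrightarrow>
     (\<exists>f. bij f \<and>
          (\<forall>x y. {x, y} \<in> edges G \<longleftrightarrow> {f x, f y} \<in> edges H) \<and>
          (\<forall>x y. {x, y} \<in> edges G \<longrightarrow> weight G {x, y} = weight H {f x, f y}))"

datatype theta_vertex = U | V | X1 | Y1 | Z1

definition theta111 ::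
  "real \<Rightarrow> real \<Rightarrow> real \<Rightarrow> real \<Rightarrow> real \<Rightarrow> real \<Rightarrow> theta_vertex wgraph" where
  "theta111 a\<^sub>1 a\<^sub>2 b\<^sub>1 b\<^sub>2 c\<^sub>1 c\<^sub>2 =
     \<lparr> edges = {{U, X1}, {X1, V}, {U, Y1}, {Y1, V}, {U, Z1}, {Z1, V}},
       weight = (\<lambda>e. if e = {U, X1} then a\<^sub>1 else if e = {X1, V} then a\<^sub>2
                     else if e = {U, Y1} then b\<^sub>1 else if e = {Y1, V} then b\<^sub>2
                     else if e = {U, Z1} then c\<^sub>1 else if e = {Z1, V} then c\<^sub>2
                     else 0) \<rparr>"

end

theory Submission
  imports Defs
begin

text \<open>
  If \<open>A\<close> is symmetric with zero diagonal and \<open>A\<^sub>x\<^sub>y \<noteq> 0\<close>, then rows \<open>x\<close> and \<open>y\<close> are independent, so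
  rank 2 means that every row is a combination of these two, and the coefficients can be read off
  in columns \<open>x\<close> and \<open>y\<close>: \<open>A\<^sub>x\<^sub>y A\<^sub>z\<^sub>t = A\<^sub>z\<^sub>y A\<^sub>x\<^sub>t + A\<^sub>z\<^sub>x A\<^sub>y\<^sub>t\<close>. Taking \<open>z = t\<close>, no vertex is adjacent to both
  \<open>x\<close> and \<open>y\<close>; since no row vanishes, the neighbours \<open>P\<close> of \<open>y\<close> and \<open>Q\<close> of \<open>x\<close> partition the
  vertices, and the identity makes the graph complete bipartite with a weight block of rank one.
  The bicyclic condition \<open>|P| |Q| = |P| + |Q| + 1\<close> is \<open>(|P| - 1) (|Q| - 1) = 2\<close>, which leaves
  only \<open>K\<^sub>2\<^sub>,\<^sub>3 = \<theta>(1,1,1)\<close>.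
\<close>

section \<open>Rank two for symmetric matrices with zero diagonal\<close>

lemma rank_eq_2_iff:
  fixes A :: "real ^ 'n ^ 'n"
  assumes sym: "\<And>i j. A $ i $ j = A $ j $ i"
    and diag: "\<And>i. A $ i $ i = 0"
    and xy: "A $ x $ y \<noteq> 0"
  shows "rank A = 2 \<longleftrightarrow>
    (\<forall>z t. A $ x $ y * A $ z $ t = A $ z $ y * A $ x $ t + A $ z $ x * A $ y $ t)"
proof -
  let ?B = "{row x A, row y A}"
  have yx: "A $ y $ x = A $ x $ y"
    by (rule sym)
  have coeffs: "a = 0 \<and> b = 0" if "a *\<^sub>R row x A + b *\<^sub>R row y A = 0" for a b
  proof -
    have "a * A $ x $ t + b * A $ y $ t = 0" for t
      using arg_cong[OF that, of "\<lambda>v. v $ t"] by (simp add: row_def)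
    \<comment> \<open>The zero diagonal leaves \<open>b * A $ y $ x = 0\<close> in column
      \<open>x\<close> and \<open>a * A $ x $ y = 0\<close> in column \<open>y\<close>.\<close>
    from this[of x] this[of y] show ?thesis
      using xy diag yx by simp
  qed
  have ne: "row x A \<noteq> row y A"
    using coeffs[of 1 "-1"] by auto
  have indep: "independent ?B"
  proof -
    have "row x A \<notin> span {row y A}"
    proof
      assume "row x A \<in> span {row y A}"
      then obtain k where "row x A = k *\<^sub>R row y A"
        by (auto simp: span_singleton)
      then show False
        using coeffs[of 1 "-k"] by simp
    qed
    moreover have "row y A \<noteq> 0"
      using coeffs[of 0 1] by auto
    ultimately show ?thesis
      using ne by (simp add: independent_insert)
  qed
  have card: "card ?B = 2"
    using ne by simp
  have sub: "?B \<subseteq> rows A"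
    by (auto simp: rows_def)
  have rank: "rank A = dim (rows A)"
    by (simp add: row_rank_def)
  \<comment> \<open>Two independent rows form a basis of the row space exactly when its dimension is
    2.\<close>
  have "rank A = 2 \<longleftrightarrow> rows A \<subseteq> span ?B"
  proof
    assume "rank A = 2"
    then show "rows A \<subseteq> span ?B"
      using card_ge_dim_independent[OF sub indep] card rank by simp
  next
    assume "rows A \<subseteq> span ?B"
    then show "rank A = 2"
      using basis_card_eq_dim[OF sub _ indep] card rank by simp
  qed
  also have "\<dots> \<longleftrightarrow>
    (\<forall>z t. A $ x $ y * A $ z $ t = A $ z $ y * A $ x $ t + A $ z $ x * A $ y $ t)"
  proof safe
    fix z t
    assume "rows A \<subseteq> span ?B"
    then have "row z A \<in> span ?B"
      by (auto simp: rows_def)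
    then obtain a b where "row z A - a *\<^sub>R row x A = b *\<^sub>R row y A"
      by (auto simp: span_insert span_singleton)
    then have "row z A = a *\<^sub>R row x A + b *\<^sub>R row y A"
      by (simp add: algebra_simps)
    from arg_cong[OF this, of "\<lambda>v. v $ _"]
    have comb: "A $ z $ s = a * A $ x $ s + b * A $ y $ s" for s
      by (simp add: row_def)
    show "A $ x $ y * A $ z $ t = A $ z $ y * A $ x $ t + A $ z $ x * A $ y $ t"
      unfolding comb[of t] comb[of x] comb[of y] diag yx by (simp add: algebra_simps)
  next
    fix r
    assume id: "\<forall>z t. A $ x $ y * A $ z $ t = A $ z $ y * A $ x $ t + A $ z $ x * A $ y $ t"
    assume "r \<in> rows A"
    then obtain z where z: "r = row z A"
      by (auto simp: rows_def)
    have "r = (A $ z $ y / A $ x $ y) *\<^sub>R row x A + (A $ z $ x / A $ x $ y) *\<^sub>R row y A"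
    proof (rule vec_eq_iff[THEN iffD2], rule allI)
      fix t
      show "r $ t = ((A $ z $ y / A $ x $ y) *\<^sub>R row x A + (A $ z $ x / A $ x $ y) *\<^sub>R row y A) $ t"
        using id[rule_format, of z t] xy by (simp add: z row_def field_simps)
    qed
    then show "r \<in> span ?B"
      by (simp only:) (intro span_add span_scale span_base; simp)
  qed
  finally show ?thesis .
qed

section \<open>From rank two to complete bipartite graphs\<close>

lemma adjacency_matrix_sym: "adjacency_matrix G $ i $ j = adjacency_matrix G $ j $ i"
  by (simp add: adjacency_matrix_def insert_commute)

lemma adjacency_matrix_diag:
  assumes "weighted_graph G"
  shows "adjacency_matrix G $ i $ i = 0"
proof -
  have "{i, i} \<notin> edges G"
    using assms unfolding weighted_graph_def
    by (metis doubleton_eq_iff)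
  then show ?thesis
    by (simp add: adjacency_matrix_def)
qed

lemma adjacency_matrix_nonzero_iff:
  assumes "weighted_graph G"
  shows "adjacency_matrix G $ i $ j \<noteq> 0 \<longleftrightarrow> {i, j} \<in> edges G"
  using assms by (auto simp: adjacency_matrix_def weighted_graph_def)

text \<open>The vertices \<open>x\<close> and \<open>y\<close> only witness that there is more than
  one vertex. The first step of a walk from \<open>z\<close> to some other vertex is then an edge at
  \<open>z\<close>.\<close>

lemma connected_graph_no_isolated:
  fixes x y :: 'v and G :: "'v wgraph"
  assumes "connected_graph G" "x \<noteq> y"
  shows "\<exists>t. {z, t} \<in> edges G"
proof -
  obtain s where "s \<noteq> z"
    using assms(2) by metis
  moreover have "(z, s) \<in> {(p, q). {p, q} \<in> edges G}\<^sup>*"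
    using assms(1) by (simp add: connected_graph_def)
  ultimately show ?thesis
    by (auto elim: converse_rtranclE)
qed

lemma rank_2_adjacency_complete_bipartite:
  fixes G :: "'v::finite wgraph"
  assumes wg: "weighted_graph G" and conn: "connected_graph G" and ne: "edges G \<noteq> {}"
    and rank: "rank (adjacency_matrix G) = 2"
  obtains P Q where "P \<inter> Q = {}" "P \<union> Q = UNIV"
    "edges G = (\<lambda>(p, q). {p, q}) ` (P \<times> Q)"
    "\<And>p p' q q'. \<lbrakk>p \<in> P; p' \<in> P; q \<in> Q; q' \<in> Q\<rbrakk> \<Longrightarrow>
       weight G {p, q} * weight G {p', q'} = weight G {p', q} * weight G {p, q'}"
proof -
  define A where "A = adjacency_matrix G"
  have sym: "A $ i $ j = A $ j $ i" for i j
    unfolding A_def by (rule adjacency_matrix_sym)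
  have diag: "A $ i $ i = 0" for i
    unfolding A_def using wg by (rule adjacency_matrix_diag)
  have edge: "A $ i $ j \<noteq> 0 \<longleftrightarrow> {i, j} \<in> edges G" for i j
    unfolding A_def using wg by (rule adjacency_matrix_nonzero_iff)
  obtain x y where xy: "x \<noteq> y" "{x, y} \<in> edges G"
    using ne wg unfolding weighted_graph_def by (metis ex_in_conv)
  have Axy: "A $ x $ y \<noteq> 0"
    using xy edge by simp
  have id: "A $ x $ y * A $ z $ t = A $ z $ y * A $ x $ t + A $ z $ x * A $ y $ t" for z t
    using rank_eq_2_iff[of A, OF sym diag Axy] rank by (simp add: A_def)
  define P where "P = {z. A $ z $ y \<noteq> 0}"
  define Q where "Q = {z. A $ z $ x \<noteq> 0}"
  have disj: "P \<inter> Q = {}"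
    using id[of z z for z] diag by (auto simp: P_def Q_def sym)
  have cover: "P \<union> Q = UNIV"
  proof -
    have "A $ z $ y \<noteq> 0 \<or> A $ z $ x \<noteq> 0" for z
    proof -
      obtain t where "A $ z $ t \<noteq> 0"
        using connected_graph_no_isolated[OF conn xy(1), of z] edge by blast
      \<comment> \<open>If both entries vanished, \<open>id\<close> would give
        \<open>A $ x $ y * A $ z $ t = 0\<close>.\<close>
      then show ?thesis
        using id[of z t] Axy by auto
    qed
    then show ?thesis
      by (auto simp: P_def Q_def)
  qed
  \<comment> \<open>Disjointness gives \<open>A $ p $ x = 0\<close>, which kills the second summand
    of \<open>id\<close>.\<close>
  have PQ: "A $ x $ y * A $ p $ q = A $ p $ y * A $ q $ x" if "p \<in> P" "q \<in> Q" for p q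
    using id[of p q] that disj by (auto simp: P_def Q_def sym)
  \<comment> \<open>The two disjuncts say when the first and the second summand of \<open>id\<close>
    are nonzero. They exclude each other, so nothing can cancel.\<close>
  have iff: "A $ i $ j \<noteq> 0 \<longleftrightarrow> i \<in> P \<and> j \<in> Q \<or> i \<in> Q \<and> j \<in> P" for i j
  proof -
    have "i \<in> P \<longleftrightarrow> i \<notin> Q" "j \<in> P \<longleftrightarrow> j \<notin> Q"
      using disj cover by auto
    then show ?thesis
      using id[of i j] Axy unfolding P_def Q_def sym[of x j] sym[of y j] by auto
  qed
  have edges: "edges G = (\<lambda>(p, q). {p, q}) ` (P \<times> Q)"
  proof (rule set_eqI, rule iffI)
    fix e
    assume e: "e \<in> edges G"
    then obtain i j where "e = {i, j}"
      using wg by (auto simp: weighted_graph_def)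
    then show "e \<in> (\<lambda>(p, q). {p, q}) ` (P \<times> Q)"
      using e edge[of i j] iff[of i j] by (auto simp: image_iff doubleton_eq_iff)
  next
    fix e
    assume "e \<in> (\<lambda>(p, q). {p, q}) ` (P \<times> Q)"
    then show "e \<in> edges G"
      using edge iff by auto
  qed
  have weight: "A $ p $ q = weight G {p, q}" if "p \<in> P" "q \<in> Q" for p q
    using that edges by (auto simp: A_def adjacency_matrix_def)
  show thesis
  proof (rule that[OF disj cover edges])
    fix p p' q q'
    assume m: "p \<in> P" "p' \<in> P" "q \<in> Q" "q' \<in> Q"
    \<comment> \<open>Scaling by the square of the nonzero entry lets \<open>PQ\<close> split each
      factor into a part in \<open>p\<close> or \<open>p'\<close> and a part in \<open>q\<close> or
      \<open>q'\<close>, so the two can be exchanged.\<close>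
    have "(A $ x $ y * A $ x $ y) * (A $ p $ q * A $ p' $ q') =
      (A $ x $ y * A $ p $ q) * (A $ x $ y * A $ p' $ q')"
      by (simp only: ac_simps)
    also have "\<dots> = (A $ x $ y * A $ p' $ q) * (A $ x $ y * A $ p $ q')"
      using m by (simp add: PQ)
    also have "\<dots> = (A $ x $ y * A $ x $ y) * (A $ p' $ q * A $ p $ q')"
      by (simp only: ac_simps)
    finally show "weight G {p, q} * weight G {p', q'} = weight G {p', q} * weight G {p, q'}"
      using Axy m by (simp add: weight)
  qed
qed

section \<open>Counting edges and recognising the theta graph\<close>

lemma card_complete_bipartite_edges:
  assumes "P \<inter> Q = {}"
  shows "card ((\<lambda>(p, q). {p, q}) ` (P \<times> Q)) = card P * card Q"
proof -
  have "inj_on (\<lambda>(p, q). {p, q}) (P \<times> Q)"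
    using assms by (auto simp: inj_on_def doubleton_eq_iff)
  then show ?thesis
    by (simp add: card_image card_cartesian_product)
qed

lemma mult_eq_add_Suc_cases:
  fixes m n :: nat
  assumes "m * n = m + n + 1"
  shows "m = 2 \<and> n = 3 \<or> m = 3 \<and> n = 2"
proof -
  have "m \<noteq> 0" "n \<noteq> 0"
    using assms by (cases m; cases n; simp)+
  \<comment> \<open>Shifting both numbers by one turns the equation into the factorisation
    \<open>k * l = 2\<close>.\<close>
  then obtain k l where kl: "m = Suc k" "n = Suc l"
    using not0_implies_Suc by blast
  then have "k * l = 2"
    using assms by simp
  then have "k dvd 2"
    by (metis dvd_triv_left)
  then have "k \<le> 2" by (auto dest: dvd_imp_le)
  then consider "k = 0" | "k = 1" | "k = 2"
    by linarith
  then show ?thesis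
    using \<open>k * l = 2\<close> kl by cases auto
qed

lemma complete_bipartite_2_3_iso_theta111:
  fixes G :: "'v::finite wgraph"
  assumes disj: "P \<inter> Q = {}" and cover: "P \<union> Q = UNIV"
    and edges: "edges G = (\<lambda>(p, q). {p, q}) ` (P \<times> Q)"
    and P: "P = {u, v}" "u \<noteq> v"
    and Q: "Q = {x, y, z}" "x \<noteq> y" "x \<noteq> z" "y \<noteq> z"
  shows "wgraph_iso G (theta111 (weight G {u, x}) (weight G {v, x})
    (weight G {u, y}) (weight G {v, y}) (weight G {u, z}) (weight G {v, z}))"
proof -
  \<comment> \<open>The part of size two supplies the poles \<open>U\<close> and \<open>V\<close>.
    The final default \<open>Z1\<close> is taken by \<open>z\<close> alone, as the five vertices
    exhaust the type.\<close>
  define f where "f i = (if i = u then U else if i = v then V else if i = x then X1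
    else if i = y then Y1 else Z1)" for i
  have dist: "u \<noteq> x" "u \<noteq> y" "u \<noteq> z" "v \<noteq> x" "v \<noteq> y" "v \<noteq> z"
    using disj P Q by auto
  have all: "i = u \<or> i = v \<or> i = x \<or> i = y \<or> i = z" for i
    using cover P Q by auto
  have f: "f u = U" "f v = V" "f x = X1" "f y = Y1" "f z = Z1"
    using dist P Q by (auto simp: f_def)
  have "inj f"
  proof (rule injI)
    fix i j
    assume "f i = f j"
    then show "i = j"
      using all[of i] all[of j] by (elim disjE) (simp_all add: f)
  qed
  moreover have "surj f"
  proof (unfold surj_def, rule allI)
    fix t
    show "\<exists>i. t = f i"
      by (cases t) (use f in metis)+
  qed
  ultimately have "bij f"
    by (simp add: bij_def)
  have ed: "edges G = {{u, x}, {v, x}, {u, y}, {v, y}, {u, z}, {v, z}}"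
    unfolding edges P Q by auto
  have "({i, j} \<in> edges G \<longleftrightarrow> {f i, f j} \<in> edges (theta111 (weight G {u, x}) (weight G {v, x})
      (weight G {u, y}) (weight G {v, y}) (weight G {u, z}) (weight G {v, z}))) \<and>
    ({i, j} \<in> edges G \<longrightarrow> weight G {i, j} = weight (theta111 (weight G {u, x}) (weight G {v, x})
      (weight G {u, y}) (weight G {v, y}) (weight G {u, z}) (weight G {v, z})) {f i, f j})" for i j
    using all[of i] all[of j]
    by (elim disjE)
      (use dist P(2) Q(2-4) in \<open>simp_all add: f ed theta111_def doubleton_eq_iff insert_commute\<close>)
  with \<open>bij f\<close> show ?thesis
    unfolding wgraph_iso_def by blast
qed

section \<open>The converse and the equivalence\<close>

lemma rank_adjacency_theta111:
  fixes G :: "'v::finite wgraph"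
  assumes wg: "weighted_graph G"
    and iso: "wgraph_iso G (theta111 a1 a2 b1 b2 c1 c2)"
    and pos: "a1 > 0" and ac: "a1 * c2 = a2 * c1" and ab: "a1 * b2 = a2 * b1"
  shows "rank (adjacency_matrix G) = 2"
proof -
  let ?H = "theta111 a1 a2 b1 b2 c1 c2"
  define A where "A = adjacency_matrix G"
  \<comment> \<open>\<open>B\<close> is the adjacency matrix of \<open>?H\<close> as a plain
    function: \<open>adjacency_matrix\<close> asks for a \<open>finite\<close> vertex type, and
    \<open>theta_vertex\<close> is not declared one.\<close>
  define B where "B i j = (if {i, j} \<in> edges ?H then weight ?H {i, j} else 0)" for i j
  obtain f where "bij f" and A: "\<And>i j. A $ i $ j = B (f i) (f j)"
    using iso unfolding wgraph_iso_def A_def B_def adjacency_matrix_def by fastforce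
  obtain x y where xy: "f x = U" "f y = X1"
    using \<open>bij f\<close> by (metis bij_pointE)
  have sym: "A $ i $ j = A $ j $ i" and diag: "A $ i $ i = 0" for i j
    unfolding A_def by (rule adjacency_matrix_sym, rule adjacency_matrix_diag[OF wg])
  \<comment> \<open>The weight conditions enter only where one index is \<open>V\<close> and the
    other \<open>Y1\<close> or \<open>Z1\<close>.\<close>
  have "B U X1 * B s t = B s X1 * B U t + B s U * B X1 t" for s t
    using ac ab
    by (cases s; cases t) (simp_all add: B_def theta111_def doubleton_eq_iff algebra_simps)
  moreover have "A $ x $ y \<noteq> 0"
    using pos by (simp add: A xy B_def theta111_def)
  ultimately show ?thesis
    using rank_eq_2_iff[of A x y, OF sym diag] by (simp add: A_def[symmetric] A xy)
qed

theorem theorem5p1: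
  fixes G :: "'v::finite wgraph"
  assumes "weighted_graph G" and "bicyclic G"
  shows "rank (adjacency_matrix G) = 2 \<longleftrightarrow>
    (\<exists>a\<^sub>1 a\<^sub>2 b\<^sub>1 b\<^sub>2 c\<^sub>1 c\<^sub>2 :: real.
       a\<^sub>1 > 0 \<and> a\<^sub>2 > 0 \<and> b\<^sub>1 > 0 \<and> b\<^sub>2 > 0 \<and> c\<^sub>1 > 0 \<and> c\<^sub>2 > 0 \<and>
       wgraph_iso G (theta111 a\<^sub>1 a\<^sub>2 b\<^sub>1 b\<^sub>2 c\<^sub>1 c\<^sub>2) \<and>
       a\<^sub>1 * c\<^sub>2 = a\<^sub>2 * c\<^sub>1 \<and> a\<^sub>1 * b\<^sub>2 = a\<^sub>2 * b\<^sub>1)"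
    (is "?L \<longleftrightarrow> ?R")
proof
  assume ?L
  have conn: "connected_graph G" and card: "card (edges G) = CARD('v) + 1"
    using assms(2) by (simp_all add: bicyclic_def)
  have "edges G \<noteq> {}"
    using card by auto
  then obtain P Q where PQ: "P \<inter> Q = {}" "P \<union> Q = UNIV"
    "edges G = (\<lambda>(p, q). {p, q}) ` (P \<times> Q)"
    "\<And>p p' q q'. \<lbrakk>p \<in> P; p' \<in> P; q \<in> Q; q' \<in> Q\<rbrakk> \<Longrightarrow>
       weight G {p, q} * weight G {p', q'} = weight G {p', q} * weight G {p, q'}"
    using rank_2_adjacency_complete_bipartite[OF assms(1) conn] \<open>?L\<close> by metis
  \<comment> \<open>Stated for arbitrary parts, since it is also applied with \<open>P\<close> and
    \<open>Q\<close> exchanged.\<close>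
  have build: ?R if "P \<inter> Q = {}" "P \<union> Q = UNIV"
    and ed: "edges G = (\<lambda>(p, q). {p, q}) ` (P \<times> Q)" and "card P = 2" "card Q = 3"
    and rel: "\<And>p p' q q'. \<lbrakk>p \<in> P; p' \<in> P; q \<in> Q; q' \<in> Q\<rbrakk> \<Longrightarrow>
       weight G {p, q} * weight G {p', q'} = weight G {p', q} * weight G {p, q'}"
    for P Q
  proof -
    obtain u v where P: "P = {u, v}" "u \<noteq> v"
      using \<open>card P = 2\<close> by (auto simp: card_2_iff)
    obtain x y z where Q: "Q = {x, y, z}" "x \<noteq> y" "x \<noteq> z" "y \<noteq> z"
      using \<open>card Q = 3\<close> by (auto simp: card_3_iff)
    have "weight G {p, q} > 0" if "p \<in> P" "q \<in> Q" for p q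
      using assms(1) that ed by (auto simp: weighted_graph_def)
    \<comment> \<open>The two weight equations are the vanishing minors of the block on columns
      \<open>x\<close>, \<open>z\<close> and \<open>x\<close>, \<open>y\<close>.\<close>
    then show ?R
      using complete_bipartite_2_3_iso_theta111[OF that(1-3) P Q]
        rel[of u v x z] rel[of u v x y] P(1) Q(1)
      by (intro exI[of _ "weight G {u, x}"] exI[of _ "weight G {v, x}"]
          exI[of _ "weight G {u, y}"] exI[of _ "weight G {v, y}"]
          exI[of _ "weight G {u, z}"] exI[of _ "weight G {v, z}"]) simp
  qed
  have "CARD('v) = card P + card Q"
    using PQ(1,2) by (metis card_Un_disjoint finite)
  then have "card P * card Q = card P + card Q + 1"
    using card card_complete_bipartite_edges[OF PQ(1)] PQ(3) by simp
  then consider "card P = 2" "card Q = 3" | "card Q = 2" "card P = 3"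
    using mult_eq_add_Suc_cases by blast
  then show ?R
  proof cases
    case 1
    then show ?thesis
      using build[OF PQ(1-3)] PQ(4) by blast
  next
    case 2
    have "edges G = (\<lambda>(p, q). {p, q}) ` (Q \<times> P)"
      unfolding PQ(3) by (auto simp: image_iff insert_commute)
    moreover have "weight G {q, p} * weight G {q', p'} = weight G {q', p} * weight G {q, p'}"
      if "q \<in> Q" "q' \<in> Q" "p \<in> P" "p' \<in> P" for p p' q q'
      using PQ(4)[of p p' q q'] that by (simp add: insert_commute mult.commute)
    ultimately show ?thesis
      using build[of Q P] PQ(1,2) 2 by (simp add: Int_commute Un_commute)
  qed
next
  assume ?R
  then show ?L
    using rank_adjacency_theta111[OF assms(1)] by blast
qed

end
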